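(* Let $T \in (\Sigma \cup \Pi)^*$ be a p-string of length $n = |T| \ge 3$. Then $\mathsf{PDAWG}(T)$ has at most $2n-1$ nodes and at most $3n-4$ edges. These bounds are tight: for every $n \ge 3$ there are p-strings $T$ of length $n$ for which $\mathsf{PDAWG}(T)$ has exactly $2n-1$ nodes, and p-strings $T$ of length $n$ for which $\mathsf{PDAWG}(T)$ has exactly $3n-4$ edges.
   Context: $\Sigma$ (static symbols) and $\Pi$ (parameter symbols) are disjoint alphabets; a p-string is a string over $\Sigma \cup \Pi$. $\mathcal{N}$ is the set of non-negative integers (disjoint from $\Sigma$). For a string $w$, $w[i]$ is its $i$-th symbol, $w[i:j]$ the factor from position $i$ to $j$ ($=\varepsilon$ if $i>j$). The prev-encoding $\mathsf{prev}(S)$ of a p-string $S$ is the string over $\Sigma\cup\mathcal{N}$ of length $|S|$ with $\mathsf{prev}(S)[i]=S[i]$ if $S[i]\in\Sigma$; $=0$ if $S[i]\in\Pi$ and $S[i]\neq S[j]$ for all $j<i$; $=i-j$ if $S[i]=S[j]\in\Pi$ with $j<i$ and $S[i]\ne S[k]$ for all $j<k<i$. A pv-string is a string of the form $\mathsf{prev}(S)$. For $a\in\Sigma\cup\mathcal{N}$ and $j\in\mathcal{N}$ let $\mathsf{Z}(a,j)=0$ if $a\in\mathcal{N}$ and $a>j$, and $\mathsf{Z}(a,j)=a$ otherwise. The re-encoding of a factor $x$ of a pv-string is $\langle x\rangle$ with $\langle x\rangle[i]=\mathsf{Z}(x[i],i-1)$. For a pv-string $w$, $\mathsf{PFactor}(w)=\{\langle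 x\rangle : x \text{ a factor of } w\}$. $\mathsf{RPos}_w(x)=\{i\in\{0,\dots,|w|\} : x=\langle w[i-|x|+1:i]\rangle\}$; $x\equiv^R_w y$ iff $\mathsf{RPos}_w(x)=\mathsf{RPos}_w(y)$, with equivalence class $[x]^R_w$; for $x \in \mathsf{PFactor}(w)$ the class is finite with elements of distinct lengths and $\max[x]^R_w$ ($\min[x]^R_w$) denotes its longest (shortest) element. The PDAWG of $T$, with $w=\mathsf{prev}(T)$, is the directed graph $\mathsf{PDAWG}(T)=(V_w,E_w)$ with $V_w=\{[x]^R_w : x\in\mathsf{PFactor}(w)\}$ and $E_w=\{([x]^R_w,c,[y]^R_w)\in V_w\times(\Sigma\cup\mathcal{N})\times V_w : y=\max[x]^R_w\cdot c\}$. *)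

theory Defs
  imports Main "HOL-Library.Sublist"
begin

text \<open>
  The disjoint unions of static symbols with parameter symbols, and of static symbols with
  non-negative integers, are rendered as sum types. List positions are 0-based.
\<close>

type_synonym ('s, 'p) pstring = "('s + 'p) list"

type_synonym 's pvword = "('s + nat) list"

definition prev_at :: "('s, 'p) pstring \<Rightarrow> nat \<Rightarrow> 's + nat" where
  "prev_at S i = (case S ! i of
      Inl a \<Rightarrow> Inl a
    | Inr x \<Rightarrow>
        if \<exists>j<i. S ! j = Inr x
        then Inr (i - (GREATEST j. j < i \<and> S ! j = Inr x))
        else Inr 0)"

definition prev :: "('s, 'p) pstring \<Rightarrow> 's pvword" where
  "prev S = map (prev_at S) [0..<length S]"

fun Z :: "'s + nat \<Rightarrow> nat \<Rightarrow> 's + nat" where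
  "Z (Inl a) j = Inl a"
| "Z (Inr k) j = (if k > j then Inr 0 else Inr k)"

text \<open>The second argument of \<open>Z\<close> is the number of symbols preceding the position.\<close>

definition reenc :: "'s pvword \<Rightarrow> 's pvword" where
  "reenc x = map (\<lambda>i. Z (x ! i) i) [0..<length x]"

definition PFactor :: "'s pvword \<Rightarrow> 's pvword set" where
  "PFactor w = {reenc x | x. sublist x w}"

text \<open>
  An end position \<open>i\<close> is the length of the prefix ending there; the factor of length \<open>length x\<close>
  ending at \<open>i\<close> exists only if \<open>length x \<le> i\<close>.
\<close>

definition RPos :: "'s pvword \<Rightarrow> 's pvword \<Rightarrow> nat set" where
  "RPos w x = {i \<in> {0..length w}. length x \<le> i \<and> x = reenc (drop (i - length x) (take i w))}"

definition rclass :: "'s pvword \<Rightarrow> 's pvword \<Rightarrow> 's pvword set" where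
  "rclass w x = {y. RPos w y = RPos w x}"

definition longest :: "'s pvword set \<Rightarrow> 's pvword" where
  "longest C = (ARG_MAX length y. y \<in> C)"

definition pdawg_nodes :: "'s pvword \<Rightarrow> 's pvword set set" where
  "pdawg_nodes w = {rclass w x | x. x \<in> PFactor w}"

definition pdawg_edges :: "'s pvword \<Rightarrow> ('s pvword set \<times> ('s + nat) \<times> 's pvword set) set" where
  "pdawg_edges w = {(rclass w x, c, rclass w y) | x c y.
      rclass w x \<in> pdawg_nodes w \<and> rclass w y \<in> pdawg_nodes w \<and>
      y = longest (rclass w x) @ [c]}"

definition PDAWG ::
  "('s, 'p) pstring \<Rightarrow> 's pvword set set \<times> ('s pvword set \<times> ('s + nat) \<times> 's pvword set) set" where
  "PDAWG T = (pdawg_nodes (prev T), pdawg_edges (prev T))"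

end

theory Submission
  imports Defs
begin

text \<open>
  Two end-position sets that meet are nested, because a factor ending at a position determines
  all shorter ones ending there. So the nodes form a laminar family, and a laminar family of
  nonempty subsets of \<open>{1..n}\<close> has at most \<open>2n - 1\<close> members; here \<open>{1}\<close> and \<open>{1..n}\<close> cannot both
  occur, and the empty word adds one node.

  Call a factor maximal if it is the longest of its class. In the trie of re-encoded factors the
  nodes of the PDAWG are the maximal vertices and its edges are the trie edges leaving maximal
  vertices. The classical injection of secondary edges into suffixes fails here, since a
  non-maximal factor may have a maximal extension to the right. Instead, the difference between
  the number of edges and the number of nonempty maximal factors is the sum over all trie edges
  of \<open>[source maximal] - [target maximal]\<close>. Cutting the trie into at most \<open>n\<close> paths, one for each
  start position, this sum telescopes; every path contributes at most \<open>1\<close>, and the path of the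
  whole word contributes \<open>0\<close>. One more unit is saved: either the last letter occurs earlier, and
  the last path is empty, or it does not, and then the laminar family is smaller.
\<close>

section \<open>Re-encoded factors\<close>

lemma length_reenc [simp]: "length (reenc x) = length x"
  by (simp add: reenc_def)

lemma nth_reenc: "i < length x \<Longrightarrow> reenc x ! i = Z (x ! i) i"
  by (simp add: reenc_def)

text \<open>A number zeroed under the looser bound \<open>j + i\<close> also exceeds
  \<open>i\<close>, and 0 is never changed.\<close>

lemma Z_Z: "Z (Z a (j + i)) i = Z a i"
  by (cases a) auto

lemma reenc_Nil [simp]: "reenc [] = []"
  by (simp add: reenc_def)

lemma take_reenc: "take k (reenc x) = reenc (take k x)"
  by (rule nth_equalityI) (auto simp: nth_reenc)

text \<open>Cutting off a prefix only tightens the bounds in \<open>Z\<close>, so the inner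
  re-encoding is absorbed. Hence a re-encoded word determines its re-encoded suffixes.\<close>

lemma reenc_drop_reenc: "reenc (drop k (reenc x)) = reenc (drop k x)"
  by (rule nth_equalityI) (auto simp: nth_reenc Z_Z)

text \<open>The factor occupies the 0-based positions from \<open>s\<close> up to but excluding
  \<open>e\<close>, so \<open>e\<close> is an end position in the sense of
  \<open>RPos\<close>.\<close>

definition pfac :: "'s pvword \<Rightarrow> nat \<Rightarrow> nat \<Rightarrow> 's pvword" where
  "pfac w s e = reenc (drop s (take e w))"

lemma length_pfac: "e \<le> length w \<Longrightarrow> length (pfac w s e) = e - s"
  by (simp add: pfac_def)

lemma pfac_Nil [simp]: "pfac w s s = []"
  by (simp add: pfac_def)

lemma take_pfac: "s + k \<le> e \<Longrightarrow> take k (pfac w s e) = pfac w s (s + k)"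
  by (simp add: pfac_def take_reenc take_drop min_def add.commute)

lemma reenc_drop_pfac: "reenc (drop k (pfac w s e)) = pfac w (s + k) e"
  by (simp add: pfac_def reenc_drop_reenc add.commute)

lemma butlast_pfac:
  assumes "s \<le> e" "Suc e \<le> length w"
  shows "butlast (pfac w s (Suc e)) = pfac w s e"
proof -
  have "butlast (pfac w s (Suc e)) = take (e - s) (pfac w s (Suc e))"
    using assms by (simp add: butlast_conv_take length_pfac)
  also have "\<dots> = pfac w s e"
    using assms by (subst take_pfac) auto
  finally show ?thesis .
qed

section \<open>End positions and their nesting\<close>

lemma mem_RPos:
  "i \<in> RPos w x \<longleftrightarrow> i \<le> length w \<and> length x \<le> i \<and> x = pfac w (i - length x) i"
  by (auto simp: RPos_def pfac_def)

lemma pfac_mem_RPos: "s \<le> e \<Longrightarrow> e \<le> length w \<Longrightarrow> e \<in> RPos w (pfac w s e)"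
  by (simp add: mem_RPos length_pfac)

lemma PFactor_eq: "PFactor w = {pfac w s e | s e. s \<le> e \<and> e \<le> length w}"
proof (intro set_eqI iffI)
  fix x assume "x \<in> PFactor w"
  then obtain u p q where "x = reenc u" "w = p @ u @ q"
    by (auto simp: PFactor_def sublist_def)
  then have "x = pfac w (length p) (length p + length u)"
    "length p + length u \<le> length w"
    by (auto simp: pfac_def)
  then show "x \<in> {pfac w s e | s e. s \<le> e \<and> e \<le> length w}"
    by force
next
  fix x assume "x \<in> {pfac w s e | s e. s \<le> e \<and> e \<le> length w}"
  then show "x \<in> PFactor w"
    unfolding PFactor_def pfac_def
    by (auto intro: sublist_order.order.trans[OF sublist_drop sublist_take])
qed

text \<open>Makes being a factor visible in the end-position set alone, hence invariant on
  classes.\<close>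

lemma PFactor_iff: "x \<in> PFactor w \<longleftrightarrow> RPos w x \<noteq> {}"
proof
  show "x \<in> PFactor w \<Longrightarrow> RPos w x \<noteq> {}"
    using pfac_mem_RPos by (fastforce simp: PFactor_eq)
  show "RPos w x \<noteq> {} \<Longrightarrow> x \<in> PFactor w"
    unfolding PFactor_eq ex_in_conv[symmetric] mem_RPos using diff_le_self by blast
qed

lemma pfac_in_PFactor: "s \<le> e \<Longrightarrow> e \<le> length w \<Longrightarrow> pfac w s e \<in> PFactor w"
  by (auto simp: PFactor_eq)

lemma Nil_in_PFactor [simp]: "[] \<in> PFactor w"
  using pfac_in_PFactor[of 0 0 w] by simp

lemma finite_PFactor: "finite (PFactor w)"
proof -
  have "PFactor w \<subseteq> (\<lambda>(s, e). pfac w s e) ` ({..length w} \<times> {..length w})"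
    by (auto simp: PFactor_eq)
  then show ?thesis
    by (rule finite_subset) auto
qed

lemma RPos_eq_length_imp_eq:
  "i \<in> RPos w x \<Longrightarrow> i \<in> RPos w y \<Longrightarrow> length x = length y \<Longrightarrow> x = y"
  by (metis mem_RPos)

text \<open>At the common end position \<open>i\<close>, \<open>x\<close> is the re-encoded suffix
  of \<open>y\<close>, and this suffix is the same wherever \<open>y\<close> ends.\<close>

lemma RPos_antimono:
  assumes "i \<in> RPos w x" "i \<in> RPos w y" "length x \<le> length y"
  shows "RPos w y \<subseteq> RPos w x"
proof
  fix j assume j: "j \<in> RPos w y"
  let ?k = "length y - length x"
  have sub: "pfac w (k - length x) k = reenc (drop ?k y)" if "k \<in> RPos w y" for k
  proof -
    have "y = pfac w (k - length y) k" "length y \<le> k"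
      using that by (auto simp: mem_RPos)
    then have "reenc (drop ?k y) = pfac w (k - length y + ?k) k"
      by (metis reenc_drop_pfac)
    also have "k - length y + ?k = k - length x"
      using \<open>length y \<le> k\<close> assms(3) by simp
    finally show ?thesis by simp
  qed
  have "x = pfac w (i - length x) i"
    using assms(1) by (auto simp: mem_RPos)
  also have "\<dots> = pfac w (j - length x) j"
    using sub[OF j] sub[OF assms(2)] by simp
  finally show "j \<in> RPos w x"
    using j assms(3) by (auto simp: mem_RPos)
qed

section \<open>Nodes and edges via longest representatives\<close>

definition maximal :: "'s pvword \<Rightarrow> 's pvword set" where
  "maximal w = {x \<in> PFactor w. \<forall>y. RPos w y = RPos w x \<longrightarrow> length y \<le> length x}"

lemma maximal_subset: "maximal w \<subseteq> PFactor w"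
  by (auto simp: maximal_def)

lemma finite_maximal: "finite (maximal w)"
  using finite_subset[OF maximal_subset finite_PFactor] .

text \<open>Mutual maximality forces equal lengths; a common end position, which exists for factors,
  then forces equality.\<close>

lemma RPos_inj_on_maximal: "inj_on (RPos w) (maximal w)"
proof (rule inj_onI)
  fix x y assume xy: "x \<in> maximal w" "y \<in> maximal w" "RPos w x = RPos w y"
  then have "length x = length y"
    by (simp add: maximal_def order_antisym)
  moreover obtain i where "i \<in> RPos w x"
    using xy(1) by (auto simp: maximal_def PFactor_iff)
  ultimately show "x = y"
    using xy(3) RPos_eq_length_imp_eq by metis
qed

lemma rclass_eq_iff: "rclass w x = rclass w y \<longleftrightarrow> RPos w x = RPos w y"
  by (auto simp: rclass_def)

lemma rclass_inj_on_maximal: "inj_on (rclass w) (maximal w)"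
  using RPos_inj_on_maximal by (auto simp: inj_on_def rclass_eq_iff)

lemma longest_rclass:
  assumes "x \<in> PFactor w"
  shows "longest (rclass w x) \<in> maximal w" "RPos w (longest (rclass w x)) = RPos w x"
proof -
  \<comment> \<open>The bound makes \<open>ARG_MAX\<close> a genuine maximum. The class of words
    that are not factors has no longest element.\<close>
  have bound: "length y < Suc (length w)" if "y \<in> rclass w x" for y
    using that assms by (auto simp: rclass_def PFactor_iff mem_RPos set_eq_iff)
  have "x \<in> rclass w x"
    by (simp add: rclass_def)
  then have l: "longest (rclass w x) \<in> rclass w x"
    "\<And>y. y \<in> rclass w x \<Longrightarrow> length y \<le> length (longest (rclass w x))"
    unfolding longest_def
    using arg_max_nat_lemma[of "\<lambda>y. y \<in> rclass w x" x length "Suc (length w)"] bound by blast+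
  show eq: "RPos w (longest (rclass w x)) = RPos w x"
    using l(1) by (simp add: rclass_def)
  show "longest (rclass w x) \<in> maximal w"
    using eq l(2) assms by (auto simp: maximal_def PFactor_iff rclass_def)
qed

lemma longest_rclass_maximal:
  assumes "x \<in> maximal w"
  shows "longest (rclass w x) = x"
proof -
  have "x \<in> PFactor w"
    using assms by (simp add: maximal_def)
  then show ?thesis
    using longest_rclass[of x w] assms by (intro inj_onD[OF RPos_inj_on_maximal]) simp_all
qed

lemma RPos_image_maximal: "RPos w ` PFactor w = RPos w ` maximal w"
proof (intro subset_antisym subsetI)
  fix R assume "R \<in> RPos w ` PFactor w"
  then obtain x where x: "x \<in> PFactor w" "R = RPos w x"
    by auto
  then show "R \<in> RPos w ` maximal w"
    using longest_rclass[OF x(1)] by (intro image_eqI) auto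
next
  fix R assume "R \<in> RPos w ` maximal w"
  then show "R \<in> RPos w ` PFactor w"
    using maximal_subset by blast
qed

lemma card_maximal: "card (maximal w) = card (RPos w ` PFactor w)"
  by (simp add: RPos_image_maximal card_image RPos_inj_on_maximal)

lemma pdawg_nodes_eq: "pdawg_nodes w = rclass w ` maximal w"
proof -
  have "rclass w x \<in> rclass w ` maximal w" if "x \<in> PFactor w" for x
    using longest_rclass[OF that] by (intro image_eqI) (auto simp: rclass_eq_iff)
  then show ?thesis
    using maximal_subset[of w] by (auto simp: pdawg_nodes_def)
qed

lemma card_pdawg_nodes: "card (pdawg_nodes w) = card (maximal w)"
  by (simp add: pdawg_nodes_eq card_image rclass_inj_on_maximal)

lemma rclass_in_nodes_iff: "rclass w x \<in> pdawg_nodes w \<longleftrightarrow> x \<in> PFactor w"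
  by (auto simp: pdawg_nodes_def rclass_eq_iff PFactor_iff)

text \<open>One word per edge: \<open>butlast\<close> gives the longest word of the source class and
  \<open>last\<close> the label, and the two recover the word.\<close>

definition maximal_ext :: "'s pvword \<Rightarrow> 's pvword set" where
  "maximal_ext w = {y \<in> PFactor w. y \<noteq> [] \<and> butlast y \<in> maximal w}"

lemma pdawg_edges_eq:
  "pdawg_edges w = (\<lambda>y. (rclass w (butlast y), last y, rclass w y)) ` maximal_ext w"
proof (intro subset_antisym subsetI)
  fix t assume "t \<in> pdawg_edges w"
  then obtain x c y where t: "t = (rclass w x, c, rclass w y)"
    and x: "x \<in> PFactor w" and y: "y \<in> PFactor w" "y = longest (rclass w x) @ [c]"
    by (auto simp: pdawg_edges_def rclass_in_nodes_iff)
  have "rclass w x = rclass w (longest (rclass w x))"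
    using longest_rclass(2)[OF x] by (simp add: rclass_eq_iff)
  then have "t = (rclass w (butlast y), last y, rclass w y)"
    using t y(2) by simp
  moreover have "y \<in> maximal_ext w"
    using y longest_rclass(1)[OF x] by (simp add: maximal_ext_def)
  ultimately show "t \<in> (\<lambda>y. (rclass w (butlast y), last y, rclass w y)) ` maximal_ext w"
    by blast
next
  fix t assume "t \<in> (\<lambda>y. (rclass w (butlast y), last y, rclass w y)) ` maximal_ext w"
  then obtain y where y: "y \<in> PFactor w" "y \<noteq> []" "butlast y \<in> maximal w"
    and t: "t = (rclass w (butlast y), last y, rclass w y)"
    by (auto simp: maximal_ext_def)
  have "y = longest (rclass w (butlast y)) @ [last y]"
    using y by (simp add: longest_rclass_maximal)
  moreover have "rclass w (butlast y) \<in> pdawg_nodes w" "rclass w y \<in> pdawg_nodes w"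
    using y maximal_subset[of w] by (auto simp: rclass_in_nodes_iff)
  ultimately show "t \<in> pdawg_edges w"
    unfolding pdawg_edges_def t by blast
qed

lemma card_pdawg_edges: "card (pdawg_edges w) = card (maximal_ext w)"
proof -
  have "inj_on (\<lambda>y. (rclass w (butlast y), last y, rclass w y)) (maximal_ext w)"
  proof (rule inj_onI)
    fix y z assume "y \<in> maximal_ext w" "z \<in> maximal_ext w"
      "(rclass w (butlast y), last y, rclass w y) = (rclass w (butlast z), last z, rclass w z)"
    then have "butlast y = butlast z" "last y = last z" "y \<noteq> []" "z \<noteq> []"
      by (auto simp: maximal_ext_def dest: inj_onD[OF rclass_inj_on_maximal])
    then show "y = z"
      by (metis append_butlast_last_id)
  qed
  then show ?thesis
    by (simp add: pdawg_edges_eq card_image)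
qed

lemma finite_maximal_ext: "finite (maximal_ext w)"
  using finite_PFactor[of w] by (simp add: maximal_ext_def)

section \<open>Laminar families\<close>

definition laminar :: "'a set set \<Rightarrow> bool" where
  "laminar F \<longleftrightarrow> (\<forall>A\<in>F. \<forall>B\<in>F. A \<inter> B = {} \<or> A \<subseteq> B \<or> B \<subseteq> A)"

lemma laminarD: "laminar F \<Longrightarrow> A \<in> F \<Longrightarrow> B \<in> F \<Longrightarrow> A \<inter> B = {} \<or> A \<subseteq> B \<or> B \<subseteq> A"
  by (simp add: laminar_def)

text \<open>Deleting one point \<open>s\<close> from the ground set costs at most two members:
  \<open>{s}\<close> itself, and one more because at most one pair of members becomes equal.\<close>

lemma laminar_card_le:
  assumes "finite S" "S \<noteq> {}" "laminar F" "F \<subseteq> Pow S" "{} \<notin> F"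
  shows "card F \<le> 2 * card S - 1"
  using assms
proof (induction S arbitrary: F rule: finite_ne_induct)
  case (singleton s)
  then have "A = {s}" if "A \<in> F" for A
    using that subset_singletonD[of A s] by auto
  then have "F \<subseteq> {{s}}"
    by auto
  then show ?case
    using card_mono[of "{{s}}" F] by simp
next
  case (insert s S)
  have finF: "finite F"
    using insert.hyps(1) insert.prems(2) by (meson finite_Pow_iff finite_insert finite_subset)
  \<comment> \<open>The nonempty traces on the smaller ground set; only \<open>{s}\<close> has an
    empty trace.\<close>
  define G where "G = (\<lambda>A. A - {s}) ` F - {{}}"
  have lamG: "laminar G"
    using insert.prems(1) unfolding laminar_def G_def by blast
  have G: "card G \<le> 2 * card S - 1"
    using lamG insert.prems(2) by (intro insert.IH) (auto simp: G_def)
  \<comment> \<open>The smaller halves of the pairs that merge when \<open>s\<close> is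
    deleted.\<close>
  define D where "D = {A \<in> F. s \<notin> A \<and> insert s A \<in> F}"
  have D: "A = B" if "A \<in> D" "B \<in> D" for A B
  proof -
    \<comment> \<open>\<open>insert s A\<close> meets \<open>B\<close> in the nonempty set
      \<open>A\<close> and is not inside \<open>B\<close>, since \<open>s\<close> is not in
      \<open>B\<close>. So laminarity puts \<open>B\<close> inside \<open>insert s A\<close>, hence
      inside \<open>A\<close>.\<close>
    have *: "A = B" if A: "A \<in> D" and B: "B \<in> D" and AB: "insert s A \<subseteq> insert s B" for A B
    proof -
      have "A \<subseteq> B" "A \<noteq> {}"
        using A B AB insert.prems(3) by (auto simp: D_def)
      moreover have "insert s A \<inter> B = {} \<or> insert s A \<subseteq> B \<or> B \<subseteq> insert s A"
        using A B by (intro laminarD[OF insert.prems(1)]) (simp_all add: D_def)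
      ultimately show ?thesis
        using A B by (auto simp: D_def)
    qed
    have "insert s A \<inter> insert s B = {} \<or> insert s A \<subseteq> insert s B \<or> insert s B \<subseteq> insert s A"
      using that by (intro laminarD[OF insert.prems(1)]) (simp_all add: D_def)
    then show ?thesis
      using *[of A B] *[of B A] that by auto
  qed
  then have "card D \<le> 1"
    by (metis One_nat_def card.infinite card_le_Suc0_iff_eq le0)
  \<comment> \<open>Distinct members with the same trace differ in \<open>s\<close> only, and then
    the smaller one lies in \<open>D\<close> or is empty.\<close>
  have inj: "inj_on (\<lambda>A. A - {s}) (F - {{s}} - D)"
  proof (rule inj_onI)
    fix A B assume AB: "A \<in> F - {{s}} - D" "B \<in> F - {{s}} - D" "A - {s} = B - {s}"
    show "A = B"
    proof (cases "s \<in> A \<longleftrightarrow> s \<in> B")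
      case True
      then show ?thesis
        using AB(3) by blast
    next
      case False
      then have "B = insert s A \<and> s \<notin> A \<or> A = insert s B \<and> s \<notin> B"
        using AB(3) by blast
      then show ?thesis
        using AB(1,2) by (auto simp: D_def)
    qed
  qed
  have "(\<lambda>A. A - {s}) ` (F - {{s}} - D) \<subseteq> G"
    using insert.prems(3) by (auto simp: G_def dest: subset_singletonD)
  then have "card (F - {{s}} - D) \<le> card G"
    using inj finF by (metis G_def card_image card_mono finite_Diff finite_imageI)
  moreover have "card F \<le> card (F - {{s}} - D) + card D + 1"
  proof -
    have "F \<subseteq> (F - {{s}} - D) \<union> D \<union> {{s}}"
      by auto
    moreover have "finite ((F - {{s}} - D) \<union> D \<union> {{s}})"
      using finF by (auto simp: D_def)
    ultimately have "card F \<le> card ((F - {{s}} - D) \<union> D \<union> {{s}})"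
      by (rule card_mono[rotated])
    also have "\<dots> \<le> card (F - {{s}} - D) + card D + 1"
      using card_Un_le[of "(F - {{s}} - D) \<union> D" "{{s}}"] card_Un_le[of "F - {{s}} - D" D] by simp
    finally show ?thesis .
  qed
  moreover have "card S > 0"
    using insert.hyps by (simp add: card_gt_0_iff)
  ultimately show ?case
    using G \<open>card D \<le> 1\<close> insert.hyps by simp
qed

text \<open>Adding \<open>{s}\<close> and \<open>S\<close> preserves laminarity, and at least one of
  them is new; the general bound for the enlarged family leaves one to spare.\<close>

lemma laminar_card_le':
  assumes "finite S" "s \<in> S" "laminar F" "F \<subseteq> Pow S" "{} \<notin> F"
    and "{s} \<notin> F \<or> S \<notin> F"
  shows "card F \<le> 2 * card S - 2"
proof -
  let ?G = "insert {s} (insert S F)"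
  have finF: "finite F"
    using assms(1,4) by (meson finite_Pow_iff finite_subset)
  have "laminar ?G"
    using assms(2,3,4) unfolding laminar_def by blast
  then have "card ?G \<le> 2 * card S - 1"
    using assms by (intro laminar_card_le) auto
  moreover have "F \<subset> ?G"
    using assms(6) by auto
  then have "card F < card ?G"
    using finF by (intro psubset_card_mono) auto
  ultimately show ?thesis
    by simp
qed

lemma laminar_RPos: "laminar (RPos w ` X)"
proof -
  have "RPos w x \<inter> RPos w y = {} \<or> RPos w x \<subseteq> RPos w y \<or> RPos w y \<subseteq> RPos w x" for x y
    using RPos_antimono[of _ w x y] RPos_antimono[of _ w y x] nat_le_linear[of "length x" "length y"]
    by blast
  then show ?thesis
    by (auto simp: laminar_def)
qed

section \<open>The bound on the number of nodes\<close>

lemma RPos_nonempty_subset: "x \<noteq> [] \<Longrightarrow> RPos w x \<subseteq> {1..length w}"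
  by (cases x) (auto simp: mem_RPos)

lemma RPos_first_position:
  assumes "x \<noteq> []" "y \<noteq> []" "1 \<in> RPos w x" "1 \<in> RPos w y"
  shows "x = y"
proof -
  have "length x = 1" "length y = 1"
    using assms by (auto simp: mem_RPos le_Suc_eq)
  then show ?thesis
    using assms RPos_eq_length_imp_eq by metis
qed

text \<open>By \<open>RPos_first_position\<close> the sets \<open>{1}\<close> and
  \<open>{1..m}\<close> would belong to the same word, yet they differ for \<open>m \<ge> 2\<close>;
  this saves one member. The range is a parameter so that the last position can be left out.\<close>

lemma card_RPos_le:
  assumes "X \<subseteq> PFactor w - {[]}" "m \<ge> 2" "\<And>x. x \<in> X \<Longrightarrow> RPos w x \<subseteq> {1..m}"
  shows "card (RPos w ` X) \<le> 2 * m - 2"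
proof -
  have "{1} \<notin> RPos w ` X \<or> {1..m} \<notin> RPos w ` X"
  proof (rule ccontr)
    assume "\<not> ?thesis"
    then obtain x y where xy: "x \<in> X" "y \<in> X" "RPos w x = {1}" "RPos w y = {1..m}"
      by (metis imageE)
    then have "x = y"
      using assms(1,2) by (intro RPos_first_position[of x y w]) auto
    then have "m \<in> {1::nat}"
      using xy assms(2) by (metis atLeastAtMost_iff le_trans one_le_numeral order_refl)
    then show False
      using assms(2) by simp
  qed
  moreover have "{} \<notin> RPos w ` X"
    using assms(1) by (auto simp: PFactor_iff)
  ultimately have "card (RPos w ` X) \<le> 2 * card {1..m} - 2"
    using assms(2,3) by (intro laminar_card_le'[where s = 1] laminar_RPos) auto
  then show ?thesis
    by simp
qed

lemma card_maximal_le_Suc: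
  "card (maximal w) \<le> Suc (card (RPos w ` (PFactor w - {[]})))"
proof -
  have "RPos w ` PFactor w = insert (RPos w []) (RPos w ` (PFactor w - {[]}))"
    using Nil_in_PFactor[of w] by blast
  then show ?thesis
    by (simp add: card_maximal card_insert_if finite_PFactor)
qed

lemma card_maximal_le:
  assumes "length w \<ge> 2"
  shows "card (maximal w) \<le> 2 * length w - 1"
proof -
  have "card (RPos w ` (PFactor w - {[]})) \<le> 2 * length w - 2"
    using assms RPos_nonempty_subset by (intro card_RPos_le) auto
  then show ?thesis
    using card_maximal_le_Suc[of w] assms by simp
qed

text \<open>A nonempty word ending at the last position has the final one-letter factor as suffix,
  so its end-position set is the same singleton. All other nonempty words end in
  \<open>{1..n - 1}\<close>. With the empty word this gives at most
  \<open>1 + 1 + (2 * (n - 1) - 2)\<close> sets, where \<open>n = length w\<close>.\<close>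

lemma card_maximal_le_unique_last:
  assumes n: "length w \<ge> 3"
    and last: "RPos w (pfac w (length w - 1) (length w)) = {length w}"
  shows "card (maximal w) \<le> 2 * length w - 2"
proof -
  let ?n = "length w"
  let ?X = "{x \<in> PFactor w - {[]}. ?n \<notin> RPos w x}"
  have "RPos w x = {?n}" if "x \<noteq> []" "?n \<in> RPos w x" for x
  proof -
    have "RPos w x \<subseteq> {?n}"
      using RPos_antimono[of ?n w "pfac w (?n - 1) ?n" x] that last n
      by (cases x) (auto simp: length_pfac)
    then show ?thesis
      using that by auto
  qed
  then have "RPos w ` (PFactor w - {[]}) \<subseteq> insert {?n} (RPos w ` ?X)"
    by blast
  then have "card (RPos w ` (PFactor w - {[]})) \<le> card (insert {?n} (RPos w ` ?X))"
    by (intro card_mono) (auto simp: finite_PFactor)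
  also have "\<dots> \<le> Suc (card (RPos w ` ?X))"
    by (simp add: card_insert_if finite_PFactor)
  also have "card (RPos w ` ?X) \<le> 2 * (?n - 1) - 2"
  proof (rule card_RPos_le)
    fix x assume x: "x \<in> ?X"
    show "RPos w x \<subseteq> {1..?n - 1}"
    proof
      fix i assume "i \<in> RPos w x"
      then have "i \<noteq> ?n" "i \<in> {1..?n}"
        using x RPos_nonempty_subset[of x w] by auto
      then show "i \<in> {1..?n - 1}"
        by auto
    qed
  qed (use n in auto)
  finally show ?thesis
    using card_maximal_le_Suc[of w] n by simp
qed

section \<open>The bound on the number of edges\<close>

text \<open>No word ending at \<open>e\<close> is longer than \<open>e\<close>.\<close>

lemma prefix_pfac_maximal:
  assumes "e \<le> length w"
  shows "pfac w 0 e \<in> maximal w"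
proof -
  have e: "e \<in> RPos w (pfac w 0 e)"
    using assms by (simp add: pfac_mem_RPos)
  then have "length y \<le> length (pfac w 0 e)" if "RPos w y = RPos w (pfac w 0 e)" for y
    using that assms mem_RPos[of e w y] by (simp add: length_pfac)
  then show ?thesis
    using assms by (simp add: maximal_def pfac_in_PFactor)
qed

text \<open>A trie edge is represented by its target \<open>y\<close>; its source is \<open>butlast y\<close>.\<close>

definition edge_weight :: "'s pvword \<Rightarrow> 's pvword set \<Rightarrow> int" where
  "edge_weight w Y =
     (\<Sum>y\<in>Y. of_bool (butlast y \<in> maximal w) - of_bool (y \<in> maximal w))"

text \<open>The first indicators count the edges, the second ones the maximal words except the empty
  one, which is the target of no trie edge; hence the \<open>- 1\<close>.\<close>

lemma card_maximal_ext_eq: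
  "int (card (maximal_ext w)) = int (card (maximal w)) - 1 + edge_weight w (PFactor w - {[]})"
proof -
  let ?N = "PFactor w - {[]}"
  have fin: "finite ?N"
    by (simp add: finite_PFactor)
  have "(\<Sum>y\<in>?N. of_bool (butlast y \<in> maximal w)) = int (card (maximal_ext w))"
  proof -
    have "maximal_ext w = ?N \<inter> {y. butlast y \<in> maximal w}"
      by (auto simp: maximal_ext_def)
    then show ?thesis
      using fin by (simp add: sum_of_bool_eq)
  qed
  moreover have "(\<Sum>y\<in>?N. of_bool (y \<in> maximal w)) = int (card (maximal w)) - 1"
  proof -
    have Nil: "[] \<in> maximal w"
      using prefix_pfac_maximal[of 0 w] by simp
    have "?N \<inter> {y. y \<in> maximal w} = maximal w - {[]}"
      using maximal_subset[of w] by auto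
    moreover have "card (maximal w) > 0"
      using Nil finite_maximal[of w] card_gt_0_iff by blast
    ultimately show ?thesis
      using fin Nil by (simp add: sum_of_bool_eq)
  qed
  ultimately show ?thesis
    by (simp add: edge_weight_def sum_subtractf)
qed

text \<open>The target of each trie edge on the path is the source of the next, so the sum
  telescopes.\<close>

lemma edge_weight_path:
  assumes "s \<le> a" "a \<le> b" "b \<le> length w"
  shows "edge_weight w (pfac w s ` {a<..b}) =
    of_bool (pfac w s a \<in> maximal w) - of_bool (pfac w s b \<in> maximal w)"
  using assms(2,3)
proof (induction b rule: dec_induct)
  case base
  then show ?case
    by (simp add: edge_weight_def)
next
  case (step b)
  \<comment> \<open>Words along a path have different lengths, so no two of them collapse in the
    image set.\<close>
  have "pfac w s (Suc b) \<notin> pfac w s ` {a<..b}"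
  proof
    assume "pfac w s (Suc b) \<in> pfac w s ` {a<..b}"
    then obtain c where "c \<in> {a<..b}" "pfac w s (Suc b) = pfac w s c"
      by auto
    then have "Suc b - s = c - s"
      using step.prems by (metis greaterThanAtMost_iff length_pfac le_SucI le_trans)
    then show False
      using \<open>c \<in> {a<..b}\<close> assms(1) by auto
  qed
  moreover have "{a<..Suc b} = insert (Suc b) {a<..b}"
    using step.hyps by auto
  ultimately show ?case
    using step assms(1) by (simp add: edge_weight_def butlast_pfac)
qed

section \<open>Cutting the trie by start positions\<close>

definition starts_before :: "'s pvword \<Rightarrow> nat \<Rightarrow> 's pvword set" where
  "starts_before w m = {pfac w s e | s e. s < m \<and> s < e \<and> e \<le> length w}"

lemma starts_beforeI:
  "s < m \<Longrightarrow> s < e \<Longrightarrow> e \<le> length w \<Longrightarrow> pfac w s e \<in> starts_before w m"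
  unfolding starts_before_def by blast

lemma finite_starts_before: "finite (starts_before w m)"
  by (rule finite_subset[OF _ finite_PFactor[of w]])
    (auto simp: starts_before_def intro: pfac_in_PFactor)

lemma starts_before_Suc:
  "starts_before w (Suc m) = starts_before w m \<union> pfac w m ` {m<..length w}"
proof (intro subset_antisym subsetI)
  fix x assume "x \<in> starts_before w (Suc m)"
  then show "x \<in> starts_before w m \<union> pfac w m ` {m<..length w}"
    by (auto simp: starts_before_def less_Suc_eq)
next
  fix x assume "x \<in> starts_before w m \<union> pfac w m ` {m<..length w}"
  then show "x \<in> starts_before w (Suc m)"
    by (auto simp: starts_before_def[of w m] intro: starts_beforeI)
qed

text \<open>Shortening the earlier occurrence by one letter gives an earlier occurrence of the
  prefix, nonempty since \<open>m < e\<close>. So along one start the known factors form an initial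
  segment.\<close>

lemma starts_before_prefix:
  assumes "pfac w m (Suc e) \<in> starts_before w m" "m < e" "Suc e \<le> length w"
  shows "pfac w m e \<in> starts_before w m"
proof -
  obtain s f where sf: "pfac w m (Suc e) = pfac w s f" "s < m" "s < f" "f \<le> length w"
    using assms(1) by (auto simp: starts_before_def)
  have "Suc e - m = f - s"
    using sf assms by (metis length_pfac)
  then obtain f' where f': "f = Suc f'" "s < f'"
    using assms(2) sf(3) by (cases f) auto
  have "pfac w m e = pfac w s f'"
    using sf f' assms butlast_pfac[of m e w] butlast_pfac[of s f' w] by simp
  then show ?thesis
    using sf f' by (simp add: starts_beforeI)
qed

text \<open>
  The factors starting at \<open>m\<close> that do not occur at an earlier start form the tail of a path in
  the trie.
\<close>

lemma edge_weight_starts_before_Suc: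
  assumes "m < length w"
  shows "edge_weight w (starts_before w (Suc m)) \<le> edge_weight w (starts_before w m) + 1"
proof -
  let ?n = "length w" and ?A = "starts_before w m"
  \<comment> \<open>\<open>e0\<close> is the end at which the path from \<open>m\<close> leaves the
    known part of the trie; it is \<open>m\<close> itself if nothing on the path is known.\<close>
  have "\<exists>e0. m \<le> e0 \<and> e0 \<le> ?n \<and> (\<forall>e\<in>{m<..?n}. pfac w m e \<in> ?A \<longleftrightarrow> e \<le> e0)"
  proof (cases "\<exists>e\<in>{m<..?n}. pfac w m e \<in> ?A")
    case True
    define E where "E = {e \<in> {m<..?n}. pfac w m e \<in> ?A}"
    have mem_E: "e \<in> E \<longleftrightarrow> m < e \<and> e \<le> ?n \<and> pfac w m e \<in> ?A" for e
      by (simp add: E_def)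
    have E: "finite E" "E \<noteq> {}"
      using True by (auto simp: E_def)
    then have "Max E \<in> E"
      by (rule Max_in)
    then have Max: "m < Max E" "Max E \<le> ?n" "pfac w m (Max E) \<in> ?A"
      unfolding mem_E by blast+
    have down: "pfac w m e \<in> ?A" if "m < e" "e \<le> Max E" for e
      using that(2)
    proof (induction rule: inc_induct)
      case base
      show ?case
        by (rule Max(3))
    next
      case (step k)
      show ?case
        by (rule starts_before_prefix) (use step that(1) Max(2) in auto)
    qed
    have "pfac w m e \<in> ?A \<longleftrightarrow> e \<le> Max E" if "e \<in> {m<..?n}" for e
    proof
      assume "pfac w m e \<in> ?A"
      then have "e \<in> E"
        using that by (simp add: mem_E)
      then show "e \<le> Max E"
        using E(1) by simp
    next
      assume "e \<le> Max E"
      then show "pfac w m e \<in> ?A"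
        using that by (intro down) auto
    qed
    then show ?thesis
      using Max(1,2) by (intro exI[of _ "Max E"]) simp
  next
    case False
    then show ?thesis
      using assms by (intro exI[of _ m]) auto
  qed
  then obtain e0 where e0: "m \<le> e0" "e0 \<le> ?n"
    and iff: "\<And>e. e \<in> {m<..?n} \<Longrightarrow> pfac w m e \<in> ?A \<longleftrightarrow> e \<le> e0"
    by blast
  have "pfac w m ` {m<..?n} - ?A = pfac w m ` {e0<..?n}"
  proof (intro subset_antisym subsetI)
    fix x assume "x \<in> pfac w m ` {m<..?n} - ?A"
    then obtain e where "x = pfac w m e" "e \<in> {m<..?n}" "\<not> e \<le> e0"
      using iff by blast
    then show "x \<in> pfac w m ` {e0<..?n}"
      by auto
  next
    fix x assume "x \<in> pfac w m ` {e0<..?n}"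
    then obtain e where "x = pfac w m e" "e \<in> {m<..?n}" "\<not> e \<le> e0"
      using e0(1) by auto
    then show "x \<in> pfac w m ` {m<..?n} - ?A"
      using iff by blast
  qed
  then have "starts_before w (Suc m) = ?A \<union> pfac w m ` {e0<..?n}" "?A \<inter> pfac w m ` {e0<..?n} = {}"
    unfolding starts_before_Suc by blast+
  then have "edge_weight w (starts_before w (Suc m)) =
      edge_weight w ?A + edge_weight w (pfac w m ` {e0<..?n})"
    by (simp add: edge_weight_def sum.union_disjoint finite_starts_before)
  \<comment> \<open>The new tail contributes a difference of two indicators, hence at most
    1.\<close>
  then show ?thesis
    using e0 by (simp add: edge_weight_path)
qed

text \<open>Both ends of the path of the whole word are maximal, so the first start costs nothing.\<close>

lemma edge_weight_starts_before:
  assumes "m < length w"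
  shows "edge_weight w (starts_before w (Suc m)) \<le> int m"
  using assms
proof (induction m)
  case 0
  have "starts_before w (Suc 0) = pfac w 0 ` {0<..length w}"
    by (auto simp: starts_before_def)
  then show ?case
    using edge_weight_path[of 0 0 "length w" w] prefix_pfac_maximal[of 0 w]
      prefix_pfac_maximal[of "length w" w] by simp
next
  case (Suc m)
  then show ?case
    using edge_weight_starts_before_Suc[of "Suc m" w] by simp
qed

lemma starts_before_length: "starts_before w (length w) = PFactor w - {[]}"
proof (intro subset_antisym subsetI)
  fix x assume "x \<in> starts_before w (length w)"
  then obtain s e where se: "x = pfac w s e" "s < e" "e \<le> length w"
    by (auto simp: starts_before_def)
  then have "length x > 0"
    by (simp add: length_pfac)
  then show "x \<in> PFactor w - {[]}"
    using se by (auto intro: pfac_in_PFactor)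
next
  fix x assume "x \<in> PFactor w - {[]}"
  then obtain s e where se: "x = pfac w s e" "s \<le> e" "e \<le> length w" "x \<noteq> []"
    by (auto simp: PFactor_eq)
  then have "s \<noteq> e"
    by auto
  then have "s < length w" "s < e"
    using se by auto
  then show "x \<in> starts_before w (length w)"
    using se by (simp add: starts_beforeI)
qed

text \<open>With \<open>n = length w\<close>, the count is \<open>(2 * n - 2) - 1 + (n - 1)\<close>
  if the final one-letter factor ends only at \<open>n\<close>, and
  \<open>(2 * n - 1) - 1 + (n - 2)\<close> otherwise; both are \<open>3 * n - 4\<close>.\<close>

lemma card_maximal_ext_le:
  assumes n: "length w \<ge> 3"
  shows "card (maximal_ext w) \<le> 3 * length w - 4"
proof -
  let ?n = "length w"
  obtain k where k: "?n = Suc (Suc k)" "k \<ge> 1"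
    using n by (metis One_nat_def Suc_le_D Suc_le_mono numeral_3_eq_3)
  let ?c = "pfac w (Suc k) ?n"
  have c: "?n \<in> RPos w ?c" "length ?c = 1"
    using k by (auto simp: pfac_mem_RPos length_pfac)
  show ?thesis
  proof (cases "RPos w ?c = {?n}")
    case True
    then have "card (maximal w) \<le> 2 * ?n - 2"
      using n k by (intro card_maximal_le_unique_last) auto
    moreover have "edge_weight w (PFactor w - {[]}) \<le> int (Suc k)"
      using edge_weight_starts_before[of "Suc k" w] k starts_before_length[of w] by simp
    ultimately show ?thesis
      using card_maximal_ext_eq[of w] k by linarith
  next
    case False
    \<comment> \<open>A second end position \<open>i\<close> yields the earlier start
      \<open>i - 1\<close>. The last path consists of \<open>?c\<close> alone, so it adds
      nothing.\<close>
    then obtain i where i: "i \<in> RPos w ?c" "i \<noteq> ?n"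
      using c by blast
    then have "?c = pfac w (i - 1) i" "i - 1 < Suc k" "i - 1 < i" "i \<le> ?n"
      using c k mem_RPos[of i w ?c] by auto
    then have "?c \<in> starts_before w (Suc k)"
      by (auto simp: starts_before_def)
    moreover have "{Suc k<..?n} = {?n}"
      using k by auto
    ultimately have "starts_before w ?n = starts_before w (Suc k)"
      using starts_before_Suc[of w "Suc k"] k by auto
    then have "edge_weight w (PFactor w - {[]}) \<le> int k"
      using edge_weight_starts_before[of k w] k starts_before_length[of w] by simp
    moreover have "card (maximal w) \<le> 2 * ?n - 1"
      using card_maximal_le[of w] n by simp
    ultimately show ?thesis
      using card_maximal_ext_eq[of w] k by linarith
  qed
qed

section \<open>Words attaining the bounds\<close>

text \<open>A single parameter at the front produces no number other than 0, which keeps the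
  extremal words unaffected by re-encoding.\<close>

lemma prev_param_Cons_static: "prev (Inr p # map Inl u) = Inr 0 # map Inl u"
proof (rule nth_equalityI)
  fix i assume "i < length (prev (Inr p # map Inl u :: ('a, 'b) pstring))"
  then have "i < Suc (length u)"
    by (simp add: prev_def)
  then have "prev (Inr p # map Inl u :: ('a, 'b) pstring) ! i = prev_at (Inr p # map Inl u) i"
    unfolding prev_def by (subst nth_map) (simp_all del: upt_Suc)
  then show "prev (Inr p # map Inl u :: ('a, 'b) pstring) ! i = (Inr 0 # map Inl u) ! i"
    using \<open>i < Suc (length u)\<close> by (cases i) (auto simp: prev_at_def)
qed (simp add: prev_def)

lemma pfac_static:
  assumes "w = Inr 0 # map Inl u"
  shows "pfac w s e = drop s (take e w)"
proof -
  have "reenc x = x" if "set x \<subseteq> insert (Inr 0) (range Inl)" for x :: "'a pvword"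
  proof (rule nth_equalityI)
    fix i assume "i < length (reenc x)"
    then have "x ! i \<in> insert (Inr 0) (range Inl)" and "i < length x"
      using that nth_mem by auto
    then show "reenc x ! i = x ! i"
      by (auto simp: nth_reenc)
  qed simp
  moreover have "set (drop s (take e w)) \<subseteq> set w"
    by (meson order_trans set_drop_subset set_take_subset)
  moreover have "set w \<subseteq> insert (Inr 0) (range Inl)"
    using assms by auto
  ultimately show ?thesis
    unfolding pfac_def by (meson order_trans)
qed

text \<open>The power with exponent \<open>k\<close> ends at \<open>k + 1\<close> and
  \<open>k + 2\<close>. A longer word ending at both has length \<open>k + 1\<close>, so it starts
  with 0 according to the first occurrence and with \<open>b\<close> according to the
  second.\<close>

lemma replicate_maximal:
  assumes w: "w = Inr 0 # map Inl (replicate m b @ u)" and "k < m"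
  shows "replicate k (Inl b) \<in> maximal w"
proof -
  have run: "pfac w (Suc j) (Suc j + l) = replicate l (Inl b)" if "j + l \<le> m" for j l
    using that unfolding pfac_static[OF w] by (simp add: w min_def)
  have len: "Suc m \<le> length w"
    by (simp add: w)
  have "Suc k \<in> RPos w (replicate k (Inl b))"
    using run[of 0 k] len \<open>k < m\<close> by (simp add: mem_RPos)
  moreover have "Suc (Suc k) \<in> RPos w (replicate k (Inl b))"
    using run[of 1 k] len \<open>k < m\<close> by (simp add: mem_RPos numeral_2_eq_2)
  moreover have "length y \<le> k" if y: "Suc k \<in> RPos w y" "Suc (Suc k) \<in> RPos w y" for y
  proof (rule ccontr)
    assume "\<not> length y \<le> k"
    moreover have "length y \<le> Suc k"
      using y(1) mem_RPos by blast
    ultimately have l: "length y = Suc k"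
      by simp
    then have "y = pfac w 0 (Suc k)" "y = pfac w (Suc 0) (Suc 0 + Suc k)"
      using y mem_RPos[of "Suc k" w y] mem_RPos[of "Suc (Suc k)" w y] by auto
    then have "pfac w 0 (Suc k) = replicate (Suc k) (Inl b)"
      using run[of 0 "Suc k"] \<open>k < m\<close> by simp
    then show False
      unfolding pfac_static[OF w] by (simp add: w)
  qed
  ultimately show ?thesis
    by (auto simp: maximal_def PFactor_iff)
qed

lemma card_prefixes: "card ((\<lambda>e. take e w) ` {..length w}) = Suc (length w)"
proof -
  have "inj_on (\<lambda>e. take e w) {..length w}"
    by (rule inj_onI) (metis atMost_iff length_take min.absorb2)
  then show ?thesis
    by (simp add: card_image)
qed

lemma card_maximal_ge:
  assumes w: "w = Inr 0 # map Inl (replicate m b)" and "m \<ge> 1"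
  shows "card (maximal w) \<ge> 2 * length w - 1"
proof -
  \<comment> \<open>All prefixes, including the empty word, and the nonempty powers below
    \<open>m\<close>: \<open>(n + 1) + (m - 1)\<close> maximal words, where \<open>n = m + 1\<close>
    is the length of \<open>w\<close>.\<close>
  let ?P = "(\<lambda>e. take e w) ` {..length w}"
  let ?R = "(\<lambda>k. replicate k (Inl b) :: 'a pvword) ` {1..<m}"
  have "?P \<inter> ?R = {}"
  proof -
    have "take e w \<noteq> replicate k (Inl b)" if "1 \<le> k" for e k
      using that by (cases e; cases k) (auto simp: w)
    then show ?thesis
      by force
  qed
  moreover have "card ?R = m - 1"
    by (subst card_image) (auto simp: inj_on_def)
  ultimately have "card (?P \<union> ?R) = Suc (length w) + (m - 1)"
    by (subst card_Un_disjoint) (simp_all only: card_prefixes finite_imageI finite_atMost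
        finite_atLeastLessThan)
  then have "card (?P \<union> ?R) = 2 * length w - 1"
    using \<open>m \<ge> 1\<close> by (simp add: w)
  moreover have "?P \<subseteq> maximal w"
    using prefix_pfac_maximal[of _ w] by (auto simp: pfac_static[OF w])
  moreover have "?R \<subseteq> maximal w"
    using replicate_maximal[of w m b "[]"] by (auto simp: w)
  ultimately show ?thesis
    by (metis Un_least card_mono finite_maximal)
qed

lemma card_maximal_ext_ge:
  assumes w: "w = Inr 0 # map Inl (replicate m b @ [a])" and "a \<noteq> b"
  shows "card (maximal_ext w) \<ge> 3 * length w - 4"
proof -
  \<comment> \<open>Extensions of proper prefixes, and extensions of each power below
    \<open>m\<close> by \<open>b\<close> and by \<open>a\<close>: \<open>(m + 2) + m + m\<close>
    words, which is \<open>3 * n - 4\<close> for \<open>n = m + 2\<close>.\<close>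
  let ?P = "(\<lambda>e. take e w) ` {..length w} - {[]}"
  let ?R = "(\<lambda>k. replicate (Suc k) (Inl b) :: 'a pvword) ` {..<m}"
  let ?S = "(\<lambda>k. replicate k (Inl b) @ [Inl a] :: 'a pvword) ` {..<m}"
  have len: "length w = Suc (Suc m)"
    by (simp add: w)
  have fac: "drop s (take e w) \<in> PFactor w" if "s \<le> e" "e \<le> length w" for s e
    using pfac_in_PFactor[OF that] by (simp add: pfac_static[OF w])
  have "?P \<subseteq> maximal_ext w"
  proof
    fix x assume "x \<in> ?P"
    then obtain e where e: "x = take e w" "e \<le> length w" "x \<noteq> []"
      by auto
    then have "butlast x = pfac w 0 (e - 1)"
      by (simp add: pfac_static[OF w] butlast_take)
    then show "x \<in> maximal_ext w"
      using e fac[of 0 e] prefix_pfac_maximal[of "e - 1" w] by (simp add: maximal_ext_def)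
  qed
  moreover have "?R \<subseteq> maximal_ext w"
  proof
    fix x assume "x \<in> ?R"
    then obtain k where k: "x = replicate (Suc k) (Inl b)" "k < m"
      by auto
    then have "x = drop 1 (take (Suc (Suc k)) w)"
      by (simp add: w min_def)
    then have "x \<in> PFactor w"
      using fac[of 1 "Suc (Suc k)"] k len by simp
    moreover have "butlast x = replicate k (Inl b)"
      unfolding k(1) replicate_Suc replicate_append_same[symmetric] by (rule butlast_snoc)
    ultimately show "x \<in> maximal_ext w"
      using replicate_maximal[OF w k(2)] k by (auto simp: maximal_ext_def)
  qed
  moreover have "?S \<subseteq> maximal_ext w"
  proof
    fix x assume "x \<in> ?S"
    then obtain k where k: "x = replicate k (Inl b) @ [Inl a]" "k < m"
      by auto
    then have "x = drop (Suc (m - k)) (take (length w) w)"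
      by (simp add: w)
    then have "x \<in> PFactor w"
      using fac[of "Suc (m - k)" "length w"] len by simp
    then show "x \<in> maximal_ext w"
      using replicate_maximal[OF w k(2)] k by (auto simp: maximal_ext_def)
  qed
  ultimately have "card (?P \<union> ?R \<union> ?S) \<le> card (maximal_ext w)"
    by (intro card_mono finite_maximal_ext) auto
  moreover have "card (?P \<union> ?R \<union> ?S) = card ?P + card ?R + card ?S"
  proof -
    \<comment> \<open>The first letter separates \<open>?P\<close> from the others, the last letter
      separates \<open>?R\<close> from \<open>?S\<close>.\<close>
    have hd: "hd x = Inr 0" if "x \<in> ?P" for x
      using that by (auto simp: w take_Cons split: nat.splits)
    have "hd x \<noteq> Inr 0" if "x \<in> ?R \<union> ?S" for x
      using that by (auto simp: hd_append split: if_splits)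
    then have "?P \<inter> (?R \<union> ?S) = {}"
      using hd by blast
    moreover have "last x = Inl b" if "x \<in> ?R" for x
      using that by (auto simp del: replicate_Suc)
    then have "?R \<inter> ?S = {}"
      using \<open>a \<noteq> b\<close> by force
    ultimately show ?thesis
      by (simp add: card_Un_disjoint Int_Un_distrib Int_Un_distrib2)
  qed
  moreover have "card ?P = Suc (Suc m)"
    using card_prefixes[of w] len by (subst card_Diff_singleton) (auto intro: image_eqI[of _ _ 0])
  moreover have "card ?R = m"
    by (subst card_image) (auto simp: inj_on_def simp del: replicate_Suc)
  moreover have "card ?S = m"
    by (subst card_image) (auto simp: inj_on_def)
  ultimately show ?thesis
    using len by simp
qed

theorem theorem1:
  shows "(\<forall>T :: ('s, 'p) pstring. length T \<ge> 3 \<longrightarrow>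
            finite (fst (PDAWG T)) \<and> card (fst (PDAWG T)) \<le> 2 * length T - 1 \<and>
            finite (snd (PDAWG T)) \<and> card (snd (PDAWG T)) \<le> 3 * length T - 4)
       \<and> (\<forall>n::nat. n \<ge> 3 \<longrightarrow>
            (\<exists>T :: ('s, 'p) pstring. length T = n \<and> card (fst (PDAWG T)) = 2 * n - 1))
       \<and> ((\<exists>a b :: 's. a \<noteq> b) \<longrightarrow>
            (\<forall>n::nat. n \<ge> 3 \<longrightarrow>
              (\<exists>T :: ('s, 'p) pstring. length T = n \<and> card (snd (PDAWG T)) = 3 * n - 4)))"
proof (intro conjI allI impI)
  fix T :: "('s, 'p) pstring" assume T: "length T \<ge> 3"
  have len: "length (prev T) = length T"
    by (simp add: prev_def)
  show "finite (fst (PDAWG T))"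
    by (simp add: PDAWG_def pdawg_nodes_eq finite_maximal)
  show "finite (snd (PDAWG T))"
    by (simp add: PDAWG_def pdawg_edges_eq finite_maximal_ext)
  show "card (fst (PDAWG T)) \<le> 2 * length T - 1"
    using card_maximal_le[of "prev T"] T by (simp add: PDAWG_def card_pdawg_nodes len)
  show "card (snd (PDAWG T)) \<le> 3 * length T - 4"
    using card_maximal_ext_le[of "prev T"] T by (simp add: PDAWG_def card_pdawg_edges len)
next
  fix n :: nat assume n: "n \<ge> 3"
  \<comment> \<open>Types are inhabited, so \<open>b\<close> and \<open>p\<close> may be arbitrary;
    the parameter serves as the second letter of the extremal word.\<close>
  fix b :: 's and p :: 'p
  let ?u = "replicate (n - 1) b"
  let ?T = "Inr p # map Inl ?u :: ('s, 'p) pstring"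
  let ?w = "Inr 0 # map Inl ?u :: 's pvword"
  have "card (maximal ?w) = 2 * n - 1"
    using card_maximal_ge[of ?w "n - 1" b] card_maximal_le[of ?w] n by simp
  then have "length ?T = n \<and> card (fst (PDAWG ?T)) = 2 * n - 1"
    using n by (simp only: PDAWG_def fst_conv card_pdawg_nodes prev_param_Cons_static) simp
  then show "\<exists>T :: ('s, 'p) pstring. length T = n \<and> card (fst (PDAWG T)) = 2 * n - 1"
    by blast
next
  fix n :: nat assume n: "n \<ge> 3"
  fix p :: 'p
  assume "\<exists>a b :: 's. a \<noteq> b"
  then obtain a b :: 's where "a \<noteq> b"
    by blast
  \<comment> \<open>The final \<open>a\<close> gives every power of \<open>b\<close> below
    \<open>n - 2\<close> a second extension.\<close>
  let ?u = "replicate (n - 2) b @ [a]"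
  let ?T = "Inr p # map Inl ?u :: ('s, 'p) pstring"
  let ?w = "Inr 0 # map Inl ?u :: 's pvword"
  have len: "length ?w = n"
    using n by simp
  have "card (maximal_ext ?w) = 3 * n - 4"
    using card_maximal_ext_ge[of ?w "n - 2" b a] card_maximal_ext_le[of ?w] n \<open>a \<noteq> b\<close>
    unfolding len by simp
  then have "length ?T = n \<and> card (snd (PDAWG ?T)) = 3 * n - 4"
    using n by (simp only: PDAWG_def snd_conv card_pdawg_edges prev_param_Cons_static) simp
  then show "\<exists>T :: ('s, 'p) pstring. length T = n \<and> card (snd (PDAWG T)) = 3 * n - 4"
    by blast
qed

end
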